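(* Let $\mathcal F$ be a finite set and let $\ell:\mathcal F\times\mathcal X\to\mathbb R$ satisfy $|\ell(f,x)|\le1$ for all $f,x$. Then the relaxation $$\mathbf{Rel}_T(\mathcal F\mid x_1,\dots,x_t)=\inf_{\lambda>0}\Big\{\frac1\lambda\log\Big(\sum_{f\in\mathcal F}\exp\Big(-\lambda\sum_{i=1}^t\ell(f,x_i)\Big)\Big)+2\lambda(T-t)\Big\}$$ is admissible, and $\mathfrak R_T(\mathcal F\mid x_1,\dots,x_t)\le\mathbf{Rel}_T(\mathcal F\mid x_1,\dots,x_t)$. Furthermore, the parameter-free version of the Exponential Weights algorithm, defined on round $t+1$ by the mixed strategy $$q_{t+1}(f)\propto\exp\Big(-\lambda_t^*\sum_{s=1}^t\ell(f,x_s)\Big),$$ with $\lambda_t^*$ the optimal value of $\lambda$ in the definition of $\mathbf{Rel}_T(\mathcal F\mid x_1,\dots,x_t)$, is an admissible algorithm for this relaxation, and its (expected) regret is bounded by $$\mathbf{Rel}_T(\mathcal F)\le2\sqrt{2T\log|\mathcal F|}.$$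
   Context: Online game: on each round $t=1,\dots,T$ the learner picks $q_t\in\Delta(\mathcal F)$ (a distribution on $\mathcal F$) and draws $f_t\sim q_t$, Nature simultaneously picks $x_t\in\mathcal X$; expected regret is the expectation of $\sum_{t}\ell(f_t,x_t)-\inf_{f\in\mathcal F}\sum_t\ell(f,x_t)$. A relaxation is a sequence of functions $\mathbf{Rel}_T(\mathcal F\mid x_1,\dots,x_t)$, $0\le t\le T$, with $\mathbf{Rel}_T(\mathcal F)$ its value for $t=0$. It is admissible if for all $x_1,\dots,x_T\in\mathcal X$, $\mathbf{Rel}_T(\mathcal F\mid x_1,\dots,x_t)\ge\inf_{q\in\Delta(\mathcal F)}\sup_{x\in\mathcal X}\{\mathbb E_{f\sim q}\ell(f,x)+\mathbf{Rel}_T(\mathcal F\mid x_1,\dots,x_t,x)\}$ for $0\le t\le T-1$, and $\mathbf{Rel}_T(\mathcal F\mid x_1,\dots,x_T)\ge-\inf_{f\in\mathcal F}\sum_{t=1}^T\ell(f,x_t)$. An algorithm is admissible for $\mathbf{Rel}$ if its $q_{t+1}$ always satisfies $\sup_{x}\{\mathbb E_{f\sim q_{t+1}}\ell(f,x)+\mathbf{Rel}_T(\mathcal F\mid x_1,\dots,x_t,x)\}\le\mathbf{Rel}_T(\mathcal F\mid x_1,\dots,x_t)$. Conditional sequential Rademacher complexity: $\mathfrak R_T(\mathcal F\mid x_1,\dots,x_t)=\sup_{\mathbf x}\mathbb E_{\epsilon_{t+1:T}}\sup_{f\in\mathcal F}\big[2\sum_{s=t+1}^T\epsilon_s\ell(f,\mathbf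 x_{s-t}(\epsilon_{t+1:s-1}))-\sum_{s=1}^t\ell(f,x_s)\big]$, with $\epsilon_s$ i.i.d. Rademacher and the supremum over $\mathcal X$-valued trees of depth $T-t$, i.e. sequences of maps $\mathbf x_i:\{\pm1\}^{i-1}\to\mathcal X$, $i=1,\dots,T-t$. *)

theory Defs
  imports "HOL-Probability.Probability"
begin

text \<open>
  Nature's moves so far are the list \<open>xs = [x\<^sub>1, \<dots>, x\<^sub>t]\<close>; a relaxation is a real function
  of such lists.  Infima and suprema over sets that need not be bounded are taken in
  \<^typ>\<open>ereal\<close>; the real-valued ones below are over bounded sets when the loss is bounded.
\<close>

definition mixed :: "'f set \<Rightarrow> 'f pmf set" where
  "mixed F = {q. set_pmf q \<subseteq> F}"

definition admissible_relaxation ::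
    "('f \<Rightarrow> 'x \<Rightarrow> real) \<Rightarrow> 'f set \<Rightarrow> 'x set \<Rightarrow> nat \<Rightarrow> ('x list \<Rightarrow> real) \<Rightarrow> bool" where
  "admissible_relaxation loss F X T Rel \<longleftrightarrow>
     (\<forall>xs. set xs \<subseteq> X \<and> length xs < T \<longrightarrow>
        ereal (Rel xs) \<ge>
          (INF q\<in>mixed F. SUP x\<in>X.
             ereal (measure_pmf.expectation q (\<lambda>f. loss f x) + Rel (xs @ [x])))) \<and>
     (\<forall>xs. set xs \<subseteq> X \<and> length xs = T \<longrightarrow>
        ereal (Rel xs) \<ge> - (INF f\<in>F. ereal (\<Sum>x\<leftarrow>xs. loss f x)))"

text \<open>
  An algorithm maps \<open>x\<^sub>1, \<dots>, x\<^sub>t\<close> to the mixed strategy \<open>q\<^sub>t\<^sub>+\<^sub>1\<close> of the next round.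
\<close>

definition admissible_algorithm ::
    "('f \<Rightarrow> 'x \<Rightarrow> real) \<Rightarrow> 'f set \<Rightarrow> 'x set \<Rightarrow> nat \<Rightarrow> ('x list \<Rightarrow> real) \<Rightarrow>
     ('x list \<Rightarrow> 'f pmf) \<Rightarrow> bool" where
  "admissible_algorithm loss F X T Rel alg \<longleftrightarrow>
     (\<forall>xs. set xs \<subseteq> X \<and> length xs < T \<longrightarrow>
        alg xs \<in> mixed F \<and>
        (SUP x\<in>X. ereal (measure_pmf.expectation (alg xs) (\<lambda>f. loss f x) + Rel (xs @ [x])))
          \<le> ereal (Rel xs))"

text \<open>
  Nature may be adaptive and randomised: its (mixed) move depends on all previous moves of both
  players.  Within a round the two moves are drawn independently given the past.
\<close>

primrec play ::
    "('x list \<Rightarrow> 'f pmf) \<Rightarrow> (('f \<times> 'x) list \<Rightarrow> 'x pmf) \<Rightarrow> nat \<Rightarrow> ('f \<times> 'x) list pmf" where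
  "play alg nature 0 = return_pmf []"
| "play alg nature (Suc t) =
     bind_pmf (play alg nature t)
       (\<lambda>h. map_pmf (\<lambda>fx. h @ [fx]) (pair_pmf (alg (map snd h)) (nature h)))"

definition regret :: "('f \<Rightarrow> 'x \<Rightarrow> real) \<Rightarrow> 'f set \<Rightarrow> ('f \<times> 'x) list \<Rightarrow> real" where
  "regret loss F h = (\<Sum>(f, x)\<leftarrow>h. loss f x) - (INF f\<in>F. \<Sum>(g, x)\<leftarrow>h. loss f x)"

definition expected_regret ::
    "('f \<Rightarrow> 'x \<Rightarrow> real) \<Rightarrow> 'f set \<Rightarrow> nat \<Rightarrow> ('x list \<Rightarrow> 'f pmf) \<Rightarrow>
     (('f \<times> 'x) list \<Rightarrow> 'x pmf) \<Rightarrow> real" where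
  "expected_regret loss F T alg nature =
     measure_pmf.expectation (play alg nature T) (regret loss F)"

text \<open>
  A tree of depth \<open>n\<close> is encoded as one function on sign lists: its \<open>i\<close>-th map is the
  restriction to the lists of length \<open>i - 1\<close>.  Values on other lists are irrelevant.
\<close>

definition trees :: "'x set \<Rightarrow> nat \<Rightarrow> (real list \<Rightarrow> 'x) set" where
  "trees X n = {tr. \<forall>\<epsilon>. set \<epsilon> \<subseteq> {-1, 1} \<and> length \<epsilon> < n \<longrightarrow> tr \<epsilon> \<in> X}"

definition rademacher :: "nat \<Rightarrow> real list pmf" where
  "rademacher n = replicate_pmf n (pmf_of_set {-1, 1})"

definition seq_rademacher ::
    "('f \<Rightarrow> 'x \<Rightarrow> real) \<Rightarrow> 'f set \<Rightarrow> 'x set \<Rightarrow> nat \<Rightarrow> 'x list \<Rightarrow> real" where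
  "seq_rademacher loss F X T xs =
     (let n = T - length xs in
      SUP tr\<in>trees X n.
        measure_pmf.expectation (rademacher n)
          (\<lambda>\<epsilon>. SUP f\<in>F. 2 * (\<Sum>i<n. \<epsilon> ! i * loss f (tr (take i \<epsilon>))) - (\<Sum>x\<leftarrow>xs. loss f x)))"

definition ew_objective ::
    "('f \<Rightarrow> 'x \<Rightarrow> real) \<Rightarrow> 'f set \<Rightarrow> nat \<Rightarrow> 'x list \<Rightarrow> real \<Rightarrow> real" where
  "ew_objective loss F T xs lam =
     1 / lam * ln (\<Sum>f\<in>F. exp (- lam * (\<Sum>x\<leftarrow>xs. loss f x))) + 2 * lam * (real T - real (length xs))"

definition ew_relaxation ::
    "('f \<Rightarrow> 'x \<Rightarrow> real) \<Rightarrow> 'f set \<Rightarrow> nat \<Rightarrow> 'x list \<Rightarrow> real" where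
  "ew_relaxation loss F T xs = (INF lam\<in>{0<..}. ew_objective loss F T xs lam)"

text \<open>
  For \<open>t < T\<close> and at least two elements in \<open>F\<close> the minimum over \<open>\<lambda> > 0\<close> is attained
  (\<open>ew_objective_attains_min\<close> below).  If \<open>F\<close> is a singleton the infimum is only approached
  as \<open>\<lambda>\<close> tends to \<open>0\<close>, but then the weights do not depend on \<open>\<lambda>\<close>.
\<close>

definition opt_rate :: "('f \<Rightarrow> 'x \<Rightarrow> real) \<Rightarrow> 'f set \<Rightarrow> nat \<Rightarrow> 'x list \<Rightarrow> real" where
  "opt_rate loss F T xs = arg_min_on (ew_objective loss F T xs) {0<..}"

definition exp_weights ::
    "('f \<Rightarrow> 'x \<Rightarrow> real) \<Rightarrow> 'f set \<Rightarrow> real \<Rightarrow> 'x list \<Rightarrow> 'f pmf" where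
  "exp_weights loss F lam xs =
     embed_pmf (\<lambda>f. if f \<in> F
       then exp (- lam * (\<Sum>x\<leftarrow>xs. loss f x)) / (\<Sum>g\<in>F. exp (- lam * (\<Sum>x\<leftarrow>xs. loss g x)))
       else 0)"

definition parameter_free_ew ::
    "('f \<Rightarrow> 'x \<Rightarrow> real) \<Rightarrow> 'f set \<Rightarrow> nat \<Rightarrow> 'x list \<Rightarrow> 'f pmf" where
  "parameter_free_ew loss F T xs = exp_weights loss F (opt_rate loss F T xs) xs"

lemma pmf_exp_weights:
  assumes "finite F" "F \<noteq> {}"
  shows "pmf (exp_weights loss F lam xs) f =
    (if f \<in> F
     then exp (- lam * (\<Sum>x\<leftarrow>xs. loss f x)) / (\<Sum>g\<in>F. exp (- lam * (\<Sum>x\<leftarrow>xs. loss g x)))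
     else 0)"
proof -
  define w where "w = (\<lambda>f. exp (- lam * (\<Sum>x\<leftarrow>xs. loss f x)))"
  have pos: "(\<Sum>g\<in>F. w g) > 0"
    using assms by (intro sum_pos) (auto simp: w_def)
  have "(\<integral>\<^sup>+f. ennreal (if f \<in> F then w f / (\<Sum>g\<in>F. w g) else 0) \<partial>count_space UNIV)
      = (\<Sum>f\<in>F. ennreal (if f \<in> F then w f / (\<Sum>g\<in>F. w g) else 0))"
    by (rule nn_integral_count_space'[OF assms(1)]) auto
  also have "\<dots> = ennreal (\<Sum>f\<in>F. w f / (\<Sum>g\<in>F. w g))"
    using pos by (subst sum_ennreal[symmetric]) (auto simp: w_def)
  also have "(\<Sum>f\<in>F. w f / (\<Sum>g\<in>F. w g)) = 1"
    using pos by (simp add: sum_divide_distrib[symmetric])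
  finally have one:
    "(\<integral>\<^sup>+f. ennreal (if f \<in> F then w f / (\<Sum>g\<in>F. w g) else 0) \<partial>count_space UNIV) = 1"
    by simp
  show ?thesis
    unfolding exp_weights_def
    by (rule pmf_embed_pmf[OF _ one[unfolded w_def]]) (auto intro!: divide_nonneg_nonneg sum_nonneg)
qed

lemma ew_objective_attains_min:
  assumes F: "finite F" "card F \<ge> 2" and t: "length xs < T"
  shows "is_arg_min (ew_objective loss F T xs) (\<lambda>lam. lam \<in> {0<..}) (opt_rate loss F T xs)"
proof -
  define L where "L = (\<lambda>f. \<Sum>x\<leftarrow>xs. loss f x)"
  define M where "M = Max (L ` F)"
  define n where "n = real T - real (length xs)"
  define g where "g = ew_objective loss F T xs"
  have n1: "n \<ge> 1" using t by (simp add: n_def)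
  have ne: "F \<noteq> {}" using F by auto
  have g_eq: "g lam = 1 / lam * ln (\<Sum>f\<in>F. exp (- lam * L f)) + 2 * lam * n" for lam
    by (simp add: g_def ew_objective_def L_def n_def)
  have spos: "(\<Sum>f\<in>F. exp (- lam * L f)) > 0" for lam
    using F ne by (intro sum_pos) auto
  have low: "g lam \<ge> ln 2 / lam - M + 2 * lam * n" if "lam > 0" for lam
  proof -
    have "2 * exp (- lam * M) \<le> real (card F) * exp (- lam * M)"
      using F by simp
    also have "\<dots> = (\<Sum>f\<in>F. exp (- lam * M))" by simp
    also have "\<dots> \<le> (\<Sum>f\<in>F. exp (- lam * L f))"
      using that F by (intro sum_mono) (auto simp: M_def)
    finally have "ln (2 * exp (- lam * M)) \<le> ln (\<Sum>f\<in>F. exp (- lam * L f))"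
      by (simp add: ln_mono)
    then have "ln 2 - lam * M \<le> ln (\<Sum>f\<in>F. exp (- lam * L f))"
      by (simp add: ln_mult)
    then have "(ln 2 - lam * M) / lam \<le> ln (\<Sum>f\<in>F. exp (- lam * L f)) / lam"
      using that by (intro divide_right_mono) auto
    then show ?thesis
      using that by (simp add: g_eq diff_divide_distrib)
  qed
  define K where "K = max 1 (g 1 + M)"
  have K1: "K \<ge> 1" by (simp add: K_def)
  define a where "a = min 1 (ln 2 / K)"
  have apos: "a > 0" using K1 by (simp add: a_def)
  have out: "g 1 \<le> g lam" if "lam > 0" "lam \<notin> {a..K}" for lam
  proof (cases "lam < a")
    case True
    then have "lam * K \<le> ln 2"
      using K1 by (simp add: a_def min_less_iff_conj pos_less_divide_eq)
    then have "K \<le> ln 2 / lam"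
      using that by (simp add: pos_le_divide_eq mult.commute)
    moreover have "0 \<le> 2 * lam * n" using that n1 by simp
    ultimately show ?thesis using low[of lam] that by (simp add: K_def)
  next
    case False
    then have "lam > K" using that by auto
    moreover have "lam \<le> 2 * lam * n"
    proof -
      have "lam * 1 \<le> lam * (2 * n)" using that n1 by (intro mult_left_mono) auto
      then show ?thesis by (simp add: ac_simps)
    qed
    moreover have "0 \<le> ln 2 / lam" using that by simp
    moreover have "g 1 + M \<le> K" by (simp add: K_def)
    ultimately show ?thesis using low[of lam] that(1) by linarith
  qed
  have "continuous_on {a..K} g"
    unfolding g_eq using apos spos by (auto intro!: continuous_intros simp: less_le)
  moreover have one: "1 \<in> {a..K}" using K1 by (simp add: a_def)
  ultimately obtain m where m: "m \<in> {a..K}" "\<And>y. y \<in> {a..K} \<Longrightarrow> g m \<le> g y"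
    using continuous_attains_inf[of "{a..K}" g] by (metis compact_Icc empty_iff)
  have "g m \<le> g lam" if "lam > 0" for lam
    using m(2)[OF one] m(2)[of lam] out[OF that] by (cases "lam \<in> {a..K}") auto
  then have "is_arg_min g (\<lambda>lam. lam \<in> {0<..}) m"
    using m(1) apos by (simp add: is_arg_min_linorder)
  then show ?thesis
    unfolding opt_rate_def arg_min_on_def arg_min_def g_def by (rule someI)
qed

end

theory Submission
  imports Defs
begin

text \<open>
  For fixed \<open>\<lambda>\<close> put \<open>\<Phi>\<^sub>\<lambda>(x\<^sub>1, \<dots>, x\<^sub>t) = 1/\<lambda> log W + 2\<lambda>(T - t)\<close>, where \<open>W\<close> is the total exponential
  weight.  A further move \<open>x\<close> multiplies \<open>W\<close> by the expectation of \<open>exp (-\<lambda> loss f x)\<close> under the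
  exponential weights, which by Hoeffding's lemma is at most \<open>exp (-\<lambda> m + \<lambda>\<^sup>2/2)\<close> with \<open>m\<close> the
  expected loss; so \<open>\<Phi>\<^sub>\<lambda>\<close> decreases by at least \<open>m\<close>.  Taking the optimal \<open>\<lambda>\<close> before the move and
  using it as a competitor after the move gives admissibility, and the relaxation plus the loss
  incurred so far is then a supermartingale along the play.  The sequential Rademacher complexity
  is bounded for each fixed \<open>\<lambda>\<close> by induction on the depth of the tree: the first sign is averaged
  out by concavity of the logarithm and \<open>cosh a \<le> exp (a\<^sup>2/2)\<close>.
\<close>

section \<open>Expectations of functions bounded on the support\<close>

lemma integrable_measure_pmf_bounded:
  fixes f :: "'a \<Rightarrow> real"
  assumes "\<And>x. x \<in> set_pmf p \<Longrightarrow> \<bar>f x\<bar> \<le> B"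
  shows "integrable (measure_pmf p) f"
  using assms by (intro measure_pmf.integrable_const_bound[of _ B]) (auto simp: AE_measure_pmf_iff)

lemma expectation_pmf_mono:
  fixes f g :: "'a \<Rightarrow> real"
  assumes "\<And>x. x \<in> set_pmf p \<Longrightarrow> \<bar>f x\<bar> \<le> B" "\<And>x. x \<in> set_pmf p \<Longrightarrow> \<bar>g x\<bar> \<le> C"
    and "\<And>x. x \<in> set_pmf p \<Longrightarrow> f x \<le> g x"
  shows "measure_pmf.expectation p f \<le> measure_pmf.expectation p g"
  using assms
  by (intro integral_mono_AE integrable_measure_pmf_bounded) (auto simp: AE_measure_pmf_iff)

text \<open>
  The library version asks for a bound on the whole space, hence the truncation \<open>g\<close>.
\<close>

lemma expectation_bind_pmf_bounded:
  fixes f :: "'b \<Rightarrow> real"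
  assumes B: "\<And>x y. x \<in> set_pmf p \<Longrightarrow> y \<in> set_pmf (q x) \<Longrightarrow> \<bar>f y\<bar> \<le> B"
  shows "measure_pmf.expectation (p \<bind> q) f =
    measure_pmf.expectation p (\<lambda>x. measure_pmf.expectation (q x) f)"
proof -
  define g where "g = (\<lambda>y. if \<bar>f y\<bar> \<le> B then f y else 0)"
  have g: "\<bar>g y\<bar> \<le> \<bar>B\<bar>" for y by (auto simp: g_def)
  have "measure_pmf.expectation (p \<bind> q) f = measure_pmf.expectation (p \<bind> q) g"
    using B by (intro integral_cong_AE) (auto simp: AE_measure_pmf_iff g_def)
  also have "\<dots> = measure_pmf.expectation p (\<lambda>x. measure_pmf.expectation (q x) g)"
    unfolding measure_pmf_bind
    using g measurable_measure_pmf[of q]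
    by (intro integral_bind[where K = "count_space UNIV" and B = "\<bar>B\<bar>" and B' = 1])
       (auto simp: measure_pmf.finite_measure_axioms measure_pmf.emeasure_space_1 simp del: space_measure_pmf)
  also have "\<dots> = measure_pmf.expectation p (\<lambda>x. measure_pmf.expectation (q x) f)"
  proof (intro integral_cong_AE)
    show "AE x in measure_pmf p.
        measure_pmf.expectation (q x) g = measure_pmf.expectation (q x) f"
      unfolding AE_measure_pmf_iff
    proof
      fix x assume "x \<in> set_pmf p"
      then show "measure_pmf.expectation (q x) g = measure_pmf.expectation (q x) f"
        using B by (intro integral_cong_AE) (auto simp: AE_measure_pmf_iff g_def)
    qed
  qed auto
  finally show ?thesis .
qed

section \<open>Exponential moments and concavity of the logarithm\<close>

lemma expectation_exp_le:
  fixes g :: "'a \<Rightarrow> real"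
  assumes g: "\<And>x. x \<in> set_pmf p \<Longrightarrow> \<bar>g x\<bar> \<le> 1" and l: "l > 0"
  shows "measure_pmf.expectation p (\<lambda>x. exp (l * g x))
    \<le> exp (l * measure_pmf.expectation p g + l\<^sup>2 / 2)"
proof -
  define m where "m = measure_pmf.expectation p g"
  \<comment> \<open>The interval \<open>[-1, 1]\<close> has length 2, so Hoeffding's exponent
    \<open>l\<^sup>2 * 2\<^sup>2 / 8\<close> is \<open>l\<^sup>2 / 2\<close>. It applies to the
    centred variable; the factor \<open>exp (l * m)\<close> restores the mean below.\<close>
  interpret interval_bounded_random_variable "measure_pmf p" g "-1" 1
    using g by unfold_locales (auto simp: AE_measure_pmf_iff abs_le_iff minus_le_iff)
  have "ennreal (measure_pmf.expectation p (\<lambda>x. exp (l * (g x - m))))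
      = (\<integral>\<^sup>+x. exp (l * (g x - m)) \<partial>measure_pmf p)"
  proof (intro nn_integral_eq_integral[symmetric])
    show "integrable (measure_pmf p) (\<lambda>x. exp (l * (g x - m)))"
      using l g
      by (intro integrable_measure_pmf_bounded[of _ _ "exp (l * (1 - m))"])
         (auto simp: abs_le_iff)
  qed auto
  also have "\<dots> \<le> ennreal (exp (l\<^sup>2 / 2))"
    using Hoeffdings_lemma_nn_integral[OF l] by (simp add: m_def)
  finally have *: "measure_pmf.expectation p (\<lambda>x. exp (l * (g x - m))) \<le> exp (l\<^sup>2 / 2)"
    by simp
  have "measure_pmf.expectation p (\<lambda>x. exp (l * g x))
      = measure_pmf.expectation p (\<lambda>x. exp (l * m) * exp (l * (g x - m)))"
    by (simp add: exp_add[symmetric] algebra_simps)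
  also have "\<dots> = exp (l * m) * measure_pmf.expectation p (\<lambda>x. exp (l * (g x - m)))"
    by simp
  also have "\<dots> \<le> exp (l * m) * exp (l\<^sup>2 / 2)"
    using * by (intro mult_left_mono) auto
  finally show ?thesis by (simp add: m_def exp_add)
qed

text \<open>The left side is the exponential moment of a random sign times \<open>a\<close>, whose
  mean is 0, so only the quadratic term of the preceding bound remains.\<close>

lemma two_point_exp_le:
  fixes l a :: real
  assumes "l > 0" "\<bar>a\<bar> \<le> 1"
  shows "(exp (l * a) + exp (- (l * a))) / 2 \<le> exp (l\<^sup>2 / 2)"
proof -
  have "measure_pmf.expectation (pmf_of_set {-1, 1 :: real}) (\<lambda>e. exp (l * (e * a)))
      \<le> exp (l * measure_pmf.expectation (pmf_of_set {-1, 1 :: real}) (\<lambda>e. e * a) + l\<^sup>2 / 2)"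
    using assms by (intro expectation_exp_le) (auto simp: abs_mult)
  then show ?thesis by (simp add: integral_pmf_of_set add.commute)
qed

lemma ln_midpoint_concave:
  fixes a b :: real
  assumes "a > 0" "b > 0"
  shows "(ln a + ln b) / 2 \<le> ln ((a + b) / 2)"
proof -
  have "ln (sqrt (a * b)) \<le> ln ((a + b) / 2)"
    using assms arith_geo_mean_sqrt[of a b] by (intro ln_mono) auto
  then show ?thesis using assms by (simp add: ln_sqrt ln_mult)
qed

lemma abs_sum_list_le_length:
  fixes g :: "'a \<Rightarrow> real"
  assumes "\<And>x. x \<in> set xs \<Longrightarrow> \<bar>g x\<bar> \<le> 1"
  shows "\<bar>\<Sum>x\<leftarrow>xs. g x\<bar> \<le> length xs"
  using assms
proof (induction xs)
  case (Cons a xs)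
  have "\<bar>g a\<bar> \<le> 1" "\<bar>\<Sum>x\<leftarrow>xs. g x\<bar> \<le> length xs" using Cons by auto
  then show ?case by simp
qed simp

section \<open>Rademacher signs and trees\<close>

text \<open>Conditioning on the first sign, the one that selects a subtree at the root. The support
  is finite, so \<open>h\<close> may be arbitrary.\<close>

lemma expectation_rademacher_Suc:
  fixes h :: "real list \<Rightarrow> real"
  shows "measure_pmf.expectation (rademacher (Suc n)) h =
    (measure_pmf.expectation (rademacher n) (\<lambda>\<epsilon>. h (1 # \<epsilon>)) +
     measure_pmf.expectation (rademacher n) (\<lambda>\<epsilon>. h (-1 # \<epsilon>))) / 2"
proof -
  have "set_pmf (rademacher n) = {\<epsilon>. set \<epsilon> \<subseteq> {-1, 1} \<and> length \<epsilon> = n}"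
    by (auto simp: rademacher_def set_replicate_pmf lists_eq_set)
  then have fin: "finite (set_pmf (rademacher n))"
    using finite_lists_length_eq[of "{-1, 1 :: real}" n] by simp
  have "rademacher (Suc n) =
      bind_pmf (pmf_of_set {-1, 1}) (\<lambda>e. map_pmf (\<lambda>\<epsilon>. e # \<epsilon>) (rademacher n))"
    by (simp add: rademacher_def map_pmf_def)
  then show ?thesis
    using fin by (simp add: pmf_expectation_bind_pmf_of_set field_simps)
qed

text \<open>
  The initial losses \<open>L\<close> and the increments \<open>g\<close> are arbitrary, so that in the induction the first
  increment can be absorbed into \<open>L\<close> and the tree replaced by one of its two subtrees.
\<close>

lemma expectation_rademacher_SUP_le:
  fixes g :: "'f \<Rightarrow> real list \<Rightarrow> real" and L :: "'f \<Rightarrow> real"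
  assumes F: "finite F" "F \<noteq> {}" and lam: "lam > 0"
    and g: "\<And>f \<epsilon>. f \<in> F \<Longrightarrow> set \<epsilon> \<subseteq> {-1, 1} \<Longrightarrow> length \<epsilon> < n \<Longrightarrow> \<bar>g f \<epsilon>\<bar> \<le> 1"
  shows "measure_pmf.expectation (rademacher n)
      (\<lambda>\<epsilon>. SUP f\<in>F. 2 * (\<Sum>i<n. \<epsilon> ! i * g f (take i \<epsilon>)) - L f)
    \<le> 1 / lam * ln (\<Sum>f\<in>F. exp (- lam * L f)) + 2 * lam * n"
  using g
proof (induction n arbitrary: g L)
  case 0
  have pos: "0 < (\<Sum>f\<in>F. exp (- (lam * L f)))" using F by (intro sum_pos) auto
  have "(SUP f\<in>F. - L f) \<le> ln (\<Sum>f\<in>F. exp (- (lam * L f))) / lam"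
  proof (rule cSUP_least[OF F(2)])
    fix f assume f: "f \<in> F"
    have "exp (- (lam * L f)) \<le> (\<Sum>f\<in>F. exp (- (lam * L f)))"
      using F f by (intro member_le_sum) auto
    then have "- (lam * L f) \<le> ln (\<Sum>f\<in>F. exp (- (lam * L f)))"
      using pos by (simp add: ln_ge_iff)
    then show "- L f \<le> ln (\<Sum>f\<in>F. exp (- (lam * L f))) / lam"
      using lam by (simp add: field_simps)
  qed
  then show ?case by (simp add: rademacher_def)
next
  case (Suc n)
  \<comment> \<open>\<open>Z e\<close> is the total weight once the root increment with sign
    \<open>e\<close> has been absorbed into \<open>L\<close>, and \<open>R e\<close> is the
    conditional expectation given that first sign.\<close>
  define Z where "Z = (\<lambda>e. \<Sum>f\<in>F. exp (- lam * (L f - 2 * e * g f [])))"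
  have Z: "Z e > 0" for e unfolding Z_def using F by (intro sum_pos) auto
  define R where "R = (\<lambda>e. measure_pmf.expectation (rademacher n)
      (\<lambda>\<epsilon>. SUP f\<in>F. 2 * (\<Sum>i<Suc n. (e # \<epsilon>) ! i * g f (take i (e # \<epsilon>))) - L f))"
  have half: "R e \<le> 1 / lam * ln (Z e) + 2 * lam * n" if e: "e \<in> {-1, 1}" for e
  proof -
    have eq: "2 * (\<Sum>i<Suc n. (e # \<epsilon>) ! i * g f (take i (e # \<epsilon>))) - L f =
        2 * (\<Sum>i<n. \<epsilon> ! i * g f (e # take i \<epsilon>)) - (L f - 2 * e * g f [])" for \<epsilon> f
      by (simp add: sum.lessThan_Suc_shift algebra_simps del: sum.lessThan_Suc)
    show ?thesis
      unfolding R_def eq Z_def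
      using Suc.IH[of "\<lambda>f \<epsilon>. g f (e # \<epsilon>)" "\<lambda>f. L f - 2 * e * g f []"] Suc.prems e
      by auto
  qed
  have "(Z 1 + Z (-1)) / 2 = (\<Sum>f\<in>F. exp (- lam * L f) *
      ((exp ((2 * lam) * g f []) + exp (- ((2 * lam) * g f []))) / 2))"
    unfolding Z_def
    by (simp add: sum.distrib[symmetric] sum_divide_distrib exp_add[symmetric] algebra_simps
        add_divide_distrib)
  also have "\<dots> \<le> (\<Sum>f\<in>F. exp (- lam * L f) * exp ((2 * lam)\<^sup>2 / 2))"
    \<comment> \<open>The factor 2 in the complexity makes the rate here \<open>2 * lam\<close>, so
      each round contributes \<open>2 * lam\<^sup>2\<close> to the logarithm. After division by
      \<open>lam\<close> this is exactly the \<open>2 * lam\<close> per remaining round.\<close>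
    using lam Suc.prems by (intro sum_mono mult_left_mono two_point_exp_le) auto
  also have "\<dots> = (\<Sum>f\<in>F. exp (- lam * L f)) * exp (2 * lam\<^sup>2)"
    by (simp add: sum_distrib_right power2_eq_square)
  finally have "ln ((Z 1 + Z (-1)) / 2) \<le> ln ((\<Sum>f\<in>F. exp (- lam * L f)) * exp (2 * lam\<^sup>2))"
    using Z[of 1] Z[of "-1"] by (intro ln_mono) auto
  moreover have "0 < (\<Sum>f\<in>F. exp (- lam * L f))" using F by (intro sum_pos) auto
  ultimately have "(ln (Z 1) + ln (Z (-1))) / 2 \<le> ln (\<Sum>f\<in>F. exp (- lam * L f)) + 2 * lam\<^sup>2"
    using ln_midpoint_concave[OF Z[of 1] Z[of "-1"]] by (simp add: ln_mult)
  then have "1 / lam * ((ln (Z 1) + ln (Z (-1))) / 2)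
      \<le> 1 / lam * (ln (\<Sum>f\<in>F. exp (- lam * L f)) + 2 * lam\<^sup>2)"
    using lam by (intro mult_left_mono) auto
  also have "\<dots> = 1 / lam * ln (\<Sum>f\<in>F. exp (- lam * L f)) + 2 * lam"
    using lam by (simp add: field_simps power2_eq_square)
  finally have mean: "(1 / lam * ln (Z 1) + 1 / lam * ln (Z (-1))) / 2
      \<le> 1 / lam * ln (\<Sum>f\<in>F. exp (- lam * L f)) + 2 * lam"
    by (simp add: add_divide_distrib)
  have "2 * lam * real (Suc n) = 2 * lam * real n + 2 * lam"
    by (simp add: algebra_simps)
  then have "(R 1 + R (-1)) / 2
      \<le> 1 / lam * ln (\<Sum>f\<in>F. exp (- lam * L f)) + 2 * lam * real (Suc n)"
    using mean half[OF insertI2[OF singletonI]] half[OF insertI1] by argo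
  then show ?case by (simp only: expectation_rademacher_Suc R_def)
qed

section \<open>The play, and regret of an admissible algorithm\<close>

lemma sum_list_case_prod_snd: "(\<Sum>(g, x)\<leftarrow>h. G x) = (\<Sum>x\<leftarrow>map snd h. G x)"
  by (simp add: case_prod_unfold o_def)

lemma set_playD:
  assumes alg: "\<And>xs. set xs \<subseteq> X \<Longrightarrow> length xs < T \<Longrightarrow> set_pmf (alg xs) \<subseteq> F"
    and nature: "\<And>h. set_pmf (nature h) \<subseteq> X"
    and "t \<le> T" "h \<in> set_pmf (play alg nature t)"
  shows "set h \<subseteq> F \<times> X \<and> length h = t"
  using assms(3, 4)
proof (induction t arbitrary: h)
  case (Suc t)
  then obtain h' f x where h: "h' \<in> set_pmf (play alg nature t)"
    "f \<in> set_pmf (alg (map snd h'))" "x \<in> set_pmf (nature h')" "h = h' @ [(f, x)]"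
    by auto
  with Suc have IH: "set h' \<subseteq> F \<times> X" "length h' = t" by auto
  then have "set_pmf (alg (map snd h')) \<subseteq> F"
    using Suc.prems by (intro alg) auto
  then show ?case using IH h nature by auto
qed simp

text \<open>The potential \<open>V\<close>, loss so far plus relaxation, starts at
  \<open>Rel []\<close>, does not increase in expectation, and dominates the regret after
  \<open>T\<close> rounds. The uniform bound on \<open>Rel\<close> makes all these expectations
  integrals of bounded functions.\<close>

lemma expected_regret_le_relaxation:
  fixes Rel :: "'x list \<Rightarrow> real"
  assumes F: "F \<noteq> {}"
    and loss: "\<And>f x. f \<in> F \<Longrightarrow> x \<in> X \<Longrightarrow> \<bar>loss f x\<bar> \<le> 1"
    and bounded: "\<And>xs. set xs \<subseteq> X \<Longrightarrow> length xs \<le> T \<Longrightarrow> \<bar>Rel xs\<bar> \<le> C"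
    and rel: "admissible_relaxation loss F X T Rel"
    and alg: "admissible_algorithm loss F X T Rel alg"
    and nature: "\<And>h. set_pmf (nature h) \<subseteq> X"
  shows "expected_regret loss F T alg nature \<le> Rel []"
proof -
  define V where "V = (\<lambda>h. (\<Sum>(f, x)\<leftarrow>h. loss f x) + Rel (map snd h))"
  define B where "B = real T + C"
  have algF: "set_pmf (alg xs) \<subseteq> F" if "set xs \<subseteq> X" "length xs < T" for xs
    using alg that by (auto simp: admissible_algorithm_def mixed_def)
  note playD = set_playD[where alg = alg and nature = nature, OF algF nature]
  have step: "measure_pmf.expectation (alg xs) (\<lambda>f. loss f x) + Rel (xs @ [x]) \<le> Rel xs"
    if "set xs \<subseteq> X" "length xs < T" "x \<in> X" for xs x
  proof -
    have "ereal (measure_pmf.expectation (alg xs) (\<lambda>f. loss f x) + Rel (xs @ [x]))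
        \<le> (SUP x\<in>X. ereal (measure_pmf.expectation (alg xs) (\<lambda>f. loss f x) + Rel (xs @ [x])))"
      using that by (intro SUP_upper)
    also have "\<dots> \<le> ereal (Rel xs)"
      using alg that by (simp add: admissible_algorithm_def)
    finally show ?thesis by simp
  qed
  have sumb: "\<bar>\<Sum>(f, x)\<leftarrow>h. loss f x\<bar> \<le> length h" if "set h \<subseteq> F \<times> X" for h
    using that loss by (intro abs_sum_list_le_length) auto
  have Vb: "\<bar>V h\<bar> \<le> B" if h: "set h \<subseteq> F \<times> X" "length h \<le> T" for h
  proof -
    have "\<bar>Rel (map snd h)\<bar> \<le> C" using h by (intro bounded) auto
    then show ?thesis using sumb[OF h(1)] h(2) by (simp add: V_def B_def)
  qed
  have dec: "measure_pmf.expectation (play alg nature t) V \<le> Rel []" if "t \<le> T" for t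
    using that
  proof (induction t)
    case (Suc t)
    define next_pmf where "next_pmf = (\<lambda>h. bind_pmf (nature h)
        (\<lambda>x. map_pmf (\<lambda>f. h @ [(f, x)]) (alg (map snd h))))"
    \<comment> \<open>Nature's move is drawn first, so that the bound for a fixed move \<open>x\<close> applies inside.\<close>
    have play_Suc: "play alg nature (Suc t) = bind_pmf (play alg nature t) next_pmf"
      unfolding next_pmf_def
      by (simp add: pair_pmf_def map_bind_pmf map_pmf_def bind_assoc_pmf bind_return_pmf)
         (subst bind_commute_pmf, simp)
    have nextb: "\<bar>V h'\<bar> \<le> B"
      if "h \<in> set_pmf (play alg nature t)" "h' \<in> set_pmf (next_pmf h)" for h h'
    proof -
      have "h' \<in> set_pmf (play alg nature (Suc t))"
        unfolding play_Suc using that by auto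
      then show ?thesis using playD[where t = "Suc t" and h = h'] Suc.prems by (intro Vb) auto
    qed
    have "measure_pmf.expectation (play alg nature (Suc t)) V =
        measure_pmf.expectation (play alg nature t) (\<lambda>h. measure_pmf.expectation (next_pmf h) V)"
      unfolding play_Suc using nextb by (intro expectation_bind_pmf_bounded) auto
    also have "\<dots> \<le> measure_pmf.expectation (play alg nature t) V"
    proof (rule expectation_pmf_mono)
      fix h assume h: "h \<in> set_pmf (play alg nature t)"
      then have h': "set h \<subseteq> F \<times> X" "length h = t" using playD[where t = t and h = h] Suc.prems by auto
      show "\<bar>V h\<bar> \<le> B" using h' Suc.prems by (intro Vb) auto
      have "\<bar>measure_pmf.expectation (next_pmf h) V\<bar>
          \<le> measure_pmf.expectation (next_pmf h) (\<lambda>h. \<bar>V h\<bar>)"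
        by (rule integral_abs_bound)
      also have "\<dots> \<le> measure_pmf.expectation (next_pmf h) (\<lambda>_. B)"
        using nextb[OF h] by (intro expectation_pmf_mono[of _ _ B _ "\<bar>B\<bar>"]) auto
      finally show "\<bar>measure_pmf.expectation (next_pmf h) V\<bar> \<le> B" by simp
      define xs where "xs = map snd h"
      have xs: "set xs \<subseteq> X" "length xs < T" using h' Suc.prems by (auto simp: xs_def)
      \<comment> \<open>With the history and the move \<open>x\<close> fixed, only the last loss
        depends on the draw of \<open>f\<close>, so this is admissibility plus the constant past
        loss. Averaging over Nature's move then preserves the bound, however that move depends on
        the history.\<close>
      have exp_x: "measure_pmf.expectation (map_pmf (\<lambda>f. h @ [(f, x)]) (alg xs)) V \<le> V h"
        if x: "x \<in> X" for x
      proof -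
        have "integrable (measure_pmf (alg xs)) (\<lambda>f. loss f x)"
          using algF[OF xs] loss x by (intro integrable_measure_pmf_bounded[of _ _ 1]) auto
        then have "measure_pmf.expectation (map_pmf (\<lambda>f. h @ [(f, x)]) (alg xs)) V =
            (\<Sum>(f, x)\<leftarrow>h. loss f x) +
            (measure_pmf.expectation (alg xs) (\<lambda>f. loss f x) + Rel (xs @ [x]))"
          by (simp add: V_def xs_def[symmetric])
        also have "\<dots> \<le> V h" using step[OF xs x] by (simp add: V_def xs_def)
        finally show ?thesis .
      qed
      have "measure_pmf.expectation (next_pmf h) V = measure_pmf.expectation (nature h)
          (\<lambda>x. measure_pmf.expectation (map_pmf (\<lambda>f. h @ [(f, x)]) (alg xs)) V)"
        unfolding next_pmf_def xs_def[symmetric]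
      proof (rule expectation_bind_pmf_bounded)
        show "\<bar>V y\<bar> \<le> B" if "x \<in> set_pmf (nature h)"
          "y \<in> set_pmf (map_pmf (\<lambda>f. h @ [(f, x)]) (alg xs))" for x y
          using that by (intro nextb[OF h]) (auto simp: next_pmf_def xs_def)
      qed
      also have "\<dots> \<le> measure_pmf.expectation (nature h) (\<lambda>_. V h)"
      proof (rule expectation_pmf_mono)
        fix x assume x: "x \<in> set_pmf (nature h)"
        then show "measure_pmf.expectation (map_pmf (\<lambda>f. h @ [(f, x)]) (alg xs)) V \<le> V h"
          using nature by (intro exp_x) auto
        have "\<bar>measure_pmf.expectation (map_pmf (\<lambda>f. h @ [(f, x)]) (alg xs)) V\<bar>
            \<le> measure_pmf.expectation (map_pmf (\<lambda>f. h @ [(f, x)]) (alg xs)) (\<lambda>h. \<bar>V h\<bar>)"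
          by (rule integral_abs_bound)
        also have "\<dots> \<le> measure_pmf.expectation (map_pmf (\<lambda>f. h @ [(f, x)]) (alg xs)) (\<lambda>_. B)"
          using nextb[OF h] x
          by (intro expectation_pmf_mono[of _ _ B _ "\<bar>B\<bar>"]) (auto simp: next_pmf_def xs_def)
        finally show "\<bar>measure_pmf.expectation (map_pmf (\<lambda>f. h @ [(f, x)]) (alg xs)) V\<bar> \<le> B"
          by simp
      qed auto
      finally show "measure_pmf.expectation (next_pmf h) V \<le> V h" by simp
    qed
    also have "\<dots> \<le> Rel []" using Suc by simp
    finally show ?case .
  qed (simp add: V_def)
  have "expected_regret loss F T alg nature \<le> measure_pmf.expectation (play alg nature T) V"
    unfolding expected_regret_def
  proof (rule expectation_pmf_mono)
    fix h assume "h \<in> set_pmf (play alg nature T)"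
    then have h: "set h \<subseteq> F \<times> X" "length h = T" using playD[where t = T and h = h] by auto
    define xs where "xs = map snd h"
    have xs: "set xs \<subseteq> X" "length xs = T" using h by (auto simp: xs_def)
    define L where "L = (\<lambda>f. \<Sum>x\<leftarrow>xs. loss f x)"
    have Lb: "\<bar>L f\<bar> \<le> T" if "f \<in> F" for f
      using abs_sum_list_le_length[of xs "loss f"] xs that loss by (auto simp: L_def)
    have reg: "regret loss F h = (\<Sum>(f, x)\<leftarrow>h. loss f x) - (INF f\<in>F. L f)"
      unfolding regret_def sum_list_case_prod_snd L_def xs_def ..
    \<comment> \<open>The terminal condition concerns an infimum in \<open>ereal\<close>; passing
      through each single \<open>f\<close> transfers it to the real infimum in
      \<open>regret\<close>.\<close>
    have "- Rel xs \<le> (INF f\<in>F. L f)"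
    proof (rule cINF_greatest[OF F])
      fix f assume "f \<in> F"
      have "- (INF f\<in>F. ereal (L f)) \<le> ereal (Rel xs)"
        using rel xs by (simp add: admissible_relaxation_def L_def)
      moreover have "(INF f\<in>F. ereal (L f)) \<le> ereal (L f)"
        using \<open>f \<in> F\<close> by (intro INF_lower)
      ultimately have "- ereal (L f) \<le> ereal (Rel xs)"
        by (meson ereal_minus_le_minus order_trans)
      then show "- Rel xs \<le> L f" by simp
    qed
    then show "regret loss F h \<le> V h" by (simp add: reg V_def xs_def)
    show "\<bar>V h\<bar> \<le> B" using h by (intro Vb) auto
    \<comment> \<open>The rest only bounds the regret by \<open>2 * real T\<close>, for
      integrability.\<close>
    have "- real T \<le> (INF f\<in>F. L f)"
      using Lb by (intro cINF_greatest[OF F]) (auto simp: abs_le_iff minus_le_iff)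
    moreover obtain f where f: "f \<in> F" using F by auto
    moreover have "(INF f\<in>F. L f) \<le> L f"
      using f Lb by (intro cINF_lower bdd_belowI2[of _ "- real T"])
        (auto simp: abs_le_iff minus_le_iff)
    moreover have "\<bar>\<Sum>(f, x)\<leftarrow>h. loss f x\<bar> \<le> T" using sumb[OF h(1)] h(2) by simp
    ultimately show "\<bar>regret loss F h\<bar> \<le> 2 * real T"
      using Lb[OF f] unfolding reg by linarith
  qed
  then show ?thesis using dec[of T] by simp
qed

section \<open>The objective, its infimum and one round of exponential weights\<close>

lemma sum_exp_pos:
  fixes G :: "'f \<Rightarrow> real"
  assumes "finite F" "F \<noteq> {}"
  shows "(\<Sum>f\<in>F. exp (G f)) > 0"
  using assms by (intro sum_pos) auto

text \<open>The total weight is at least the single summand of \<open>f\<close>, and the linear term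
  is nonnegative. This bounds the objective below uniformly in \<open>lam\<close>, so that its real
  infimum is meaningful, and it also yields the terminal condition of admissibility.\<close>

lemma ew_objective_ge:
  assumes F: "finite F" "f \<in> F" and lam: "lam > 0" and xs: "length xs \<le> T"
  shows "- (\<Sum>x\<leftarrow>xs. loss f x) \<le> ew_objective loss F T xs lam"
proof -
  define L where "L = (\<lambda>f. \<Sum>x\<leftarrow>xs. loss f x)"
  have "exp (- lam * L f) \<le> (\<Sum>f\<in>F. exp (- lam * L f))"
    using F by (intro member_le_sum) auto
  then have "- lam * L f \<le> ln (\<Sum>f\<in>F. exp (- lam * L f))"
    using sum_exp_pos[of F "\<lambda>f. - lam * L f"] F by (subst ln_ge_iff) auto
  then have "- L f \<le> 1 / lam * ln (\<Sum>f\<in>F. exp (- lam * L f))"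
    using lam by (simp add: field_simps)
  moreover have "0 \<le> 2 * lam * (real T - real (length xs))" using lam xs by simp
  ultimately show ?thesis by (simp add: ew_objective_def L_def)
qed

lemma ew_relaxation_le:
  assumes "finite F" "F \<noteq> {}" "lam > 0" "length xs \<le> T"
  shows "ew_relaxation loss F T xs \<le> ew_objective loss F T xs lam"
proof -
  obtain f where "f \<in> F" using assms by auto
  then show ?thesis
    unfolding ew_relaxation_def using assms
    by (intro cINF_lower bdd_belowI2[of _ "- (\<Sum>x\<leftarrow>xs. loss f x)"] ew_objective_ge) auto
qed

lemma ew_relaxation_ge:
  assumes "\<And>lam. lam > 0 \<Longrightarrow> c \<le> ew_objective loss F T xs lam"
  shows "c \<le> ew_relaxation loss F T xs"
  unfolding ew_relaxation_def
  by (rule cINF_greatest) (use assms in \<open>auto simp: greaterThan_non_empty\<close>)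

lemma set_exp_weights:
  assumes "finite F" "F \<noteq> {}"
  shows "set_pmf (exp_weights loss F lam xs) \<subseteq> F"
  using assms by (auto simp: set_pmf_eq pmf_exp_weights split: if_splits)

lemma expectation_exp_weights:
  assumes F: "finite F" "F \<noteq> {}"
  shows "measure_pmf.expectation (exp_weights loss F lam xs) G =
    (\<Sum>f\<in>F. exp (- lam * (\<Sum>x\<leftarrow>xs. loss f x)) * G f) /
    (\<Sum>f\<in>F. exp (- lam * (\<Sum>x\<leftarrow>xs. loss f x)))"
  using set_exp_weights[OF F]
  by (subst integral_measure_pmf_real[OF F(1)])
     (auto simp: pmf_exp_weights[OF F] sum_divide_distrib mult_ac)

lemma ew_objective_step:
  assumes F: "finite F" "F \<noteq> {}" and lam: "lam > 0"
    and loss: "\<And>f. f \<in> F \<Longrightarrow> \<bar>loss f x\<bar> \<le> 1"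
  shows "measure_pmf.expectation (exp_weights loss F lam xs) (\<lambda>f. loss f x)
      + ew_objective loss F T (xs @ [x]) lam \<le> ew_objective loss F T xs lam"
proof -
  define q where "q = exp_weights loss F lam xs"
  define w where "w = (\<lambda>f. exp (- lam * (\<Sum>x\<leftarrow>xs. loss f x)))"
  define W where "W = (\<Sum>f\<in>F. w f)"
  define m where "m = measure_pmf.expectation q (\<lambda>f. loss f x)"
  define E where "E = measure_pmf.expectation q (\<lambda>f. exp (lam * - loss f x))"
  have W: "W > 0" unfolding W_def w_def by (rule sum_exp_pos[OF F])
  have E_eq: "E = (\<Sum>f\<in>F. w f * exp (lam * - loss f x)) / W"
    by (simp add: E_def q_def expectation_exp_weights[OF F] w_def W_def)
  have "(\<Sum>f\<in>F. exp (- lam * (\<Sum>x\<leftarrow>xs @ [x]. loss f x))) =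
      (\<Sum>f\<in>F. w f * exp (lam * - loss f x))"
    by (simp add: w_def exp_add[symmetric] algebra_simps)
  \<comment> \<open>The new total weight is the old one times an expectation under the current
    strategy, to which the exponential moment bound applies.\<close>
  also have "\<dots> = W * E" using W by (simp add: E_eq)
  finally have sum_eq: "(\<Sum>f\<in>F. exp (- lam * (\<Sum>x\<leftarrow>xs @ [x]. loss f x))) = W * E" .
  have Epos: "E > 0" unfolding E_eq using W F
    by (intro divide_pos_pos sum_pos mult_pos_pos) (auto simp: w_def)
  have "E \<le> exp (lam * measure_pmf.expectation q (\<lambda>f. - loss f x) + lam\<^sup>2 / 2)"
    unfolding E_def q_def using lam loss set_exp_weights[OF F, of loss lam xs]
    by (intro expectation_exp_le) auto
  then have "ln E \<le> - lam * m + lam\<^sup>2 / 2"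
    using Epos by (simp add: m_def flip: exp_le_cancel_iff[of "ln E"])
  then have "1 / lam * ln E \<le> 1 / lam * (- lam * m + lam\<^sup>2 / 2)"
    using lam by (intro mult_left_mono) auto
  also have "\<dots> = - m + lam / 2" using lam by (simp add: field_simps power2_eq_square)
  finally have lnE: "1 / lam * ln E \<le> - m + lam / 2" .
  have "ew_objective loss F T (xs @ [x]) lam =
      1 / lam * ln W + 1 / lam * ln E + 2 * lam * (real T - real (length xs)) - 2 * lam"
    unfolding ew_objective_def sum_eq using W Epos by (simp add: ln_mult algebra_simps add_divide_distrib)
  moreover have "ew_objective loss F T xs lam =
      1 / lam * ln W + 2 * lam * (real T - real (length xs))"
    by (simp add: ew_objective_def W_def w_def)
  \<comment> \<open>Hoeffding's term costs \<open>lam / 2\<close>, while having one round fewer to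
    go frees \<open>2 * lam\<close>.\<close>
  ultimately show ?thesis using lnE lam by (simp add: m_def q_def)
qed

text \<open>It suffices to compare with the objective at every \<open>lam\<close>. The strategy is
  exponential weights at some rate \<open>mu\<close> that does at least as well as
  \<open>lam\<close> before the move, and the same \<open>mu\<close> bounds the infimum after the
  move.\<close>

lemma parameter_free_ew_step:
  assumes F: "finite F" "F \<noteq> {}" and xs: "length xs < T"
    and loss: "\<And>f. f \<in> F \<Longrightarrow> \<bar>loss f x\<bar> \<le> 1"
  shows "measure_pmf.expectation (parameter_free_ew loss F T xs) (\<lambda>f. loss f x)
      + ew_relaxation loss F T (xs @ [x]) \<le> ew_relaxation loss F T xs"
proof (rule ew_relaxation_ge)
  fix lam :: real assume lam: "lam > 0"
  obtain mu where mu: "mu > 0" "ew_objective loss F T xs mu \<le> ew_objective loss F T xs lam"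
    "parameter_free_ew loss F T xs = exp_weights loss F mu xs"
  proof (cases "card F \<ge> 2")
    case True
    from ew_objective_attains_min[where loss = loss, OF F(1) this xs] lam show ?thesis
      by (intro that[of "opt_rate loss F T xs"])
         (auto simp: is_arg_min_linorder parameter_free_ew_def)
  next
    case False
    moreover have "card F > 0" using F by (simp add: card_gt_0_iff)
    ultimately have "card F = 1" by simp
    then obtain f where "F = {f}" by (auto simp: card_1_singleton_iff)
    \<comment> \<open>For a singleton the minimum need not be attained and \<open>opt_rate\<close>
      may be an arbitrary value, but every rate gives the point mass at \<open>f\<close>, so
      \<open>mu\<close> can be \<open>lam\<close> itself.\<close>
    then have "exp_weights loss F l xs = exp_weights loss F lam xs" for l
      by (intro pmf_eqI) (simp add: pmf_exp_weights)
    then show ?thesis using lam by (intro that[of lam]) (auto simp: parameter_free_ew_def)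
  qed
  have "ew_relaxation loss F T (xs @ [x]) \<le> ew_objective loss F T (xs @ [x]) mu"
    using F mu xs by (intro ew_relaxation_le) auto
  with ew_objective_step[where loss = loss and T = T and x = x and xs = xs, OF F mu(1) loss] mu(2)
  show "measure_pmf.expectation (parameter_free_ew loss F T xs) (\<lambda>f. loss f x)
      + ew_relaxation loss F T (xs @ [x]) \<le> ew_objective loss F T xs lam"
    unfolding mu(3) by linarith
qed

text \<open>A crude bound, serving as the uniform bound that the regret argument asks for. Above,
  the rate 1 is used: the losses contribute at most \<open>T\<close> and the linear term at most
  \<open>2 * T\<close>. Below, any single \<open>f\<close> suffices.\<close>

lemma ew_relaxation_bounded:
  assumes F: "finite F" "F \<noteq> {}" and xs: "length xs \<le> T" "set xs \<subseteq> X"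
    and loss: "\<And>f x. f \<in> F \<Longrightarrow> x \<in> X \<Longrightarrow> \<bar>loss f x\<bar> \<le> 1"
  shows "\<bar>ew_relaxation loss F T xs\<bar> \<le> ln (card F) + 3 * real T"
proof -
  define L where "L = (\<lambda>f. \<Sum>x\<leftarrow>xs. loss f x)"
  have L: "\<bar>L f\<bar> \<le> T" if "f \<in> F" for f
  proof -
    have "\<bar>L f\<bar> \<le> length xs"
      unfolding L_def using that xs loss by (intro abs_sum_list_le_length) auto
    then show ?thesis using xs by simp
  qed
  have c: "card F \<ge> 1" using F by (simp add: Suc_le_eq card_gt_0_iff)
  have "(\<Sum>f\<in>F. exp (- 1 * L f)) \<le> (\<Sum>f\<in>F. exp (real T))"
    using L by (intro sum_mono) (auto simp: abs_le_iff)
  then have "ln (\<Sum>f\<in>F. exp (- 1 * L f)) \<le> ln (card F * exp (real T))"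
    using sum_exp_pos[OF F] by (intro ln_mono) auto
  also have "\<dots> = ln (card F) + T" using c by (simp add: ln_mult)
  finally have "ew_objective loss F T xs 1 \<le> ln (card F) + 3 * real T"
    by (simp add: ew_objective_def L_def)
  moreover have "ew_relaxation loss F T xs \<le> ew_objective loss F T xs 1"
    using F xs by (intro ew_relaxation_le) auto
  moreover obtain f where f: "f \<in> F" using F by auto
  moreover have "- L f \<le> ew_relaxation loss F T xs"
    unfolding L_def using F f xs by (intro ew_relaxation_ge ew_objective_ge) auto
  moreover have "0 \<le> ln (card F)" using c by simp
  ultimately show ?thesis using L[OF f] by (simp add: abs_le_iff)
qed

section \<open>The closed-form bound at the empty history\<close>

text \<open>For positive \<open>a\<close> and \<open>b\<close> the right side is minimal at
  \<open>l = sqrt (a / b)\<close>. If \<open>a = 0\<close> or \<open>b = 0\<close>, values at most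
  any given \<open>e > 0\<close> are reached by a suitable \<open>l\<close>. These cases do occur:
  \<open>a = 0\<close> when \<open>F\<close> is a singleton, \<open>b = 0\<close> when
  \<open>T = 0\<close>.\<close>

lemma le_two_sqrtI:
  fixes a b c :: real
  assumes a: "a \<ge> 0" and b: "b \<ge> 0" and c: "\<And>l. l > 0 \<Longrightarrow> c \<le> a / l + b * l"
  shows "c \<le> 2 * sqrt (a * b)"
proof -
  consider "a > 0" "b > 0" | "a = 0" | "b = 0" using a b by fastforce
  then show ?thesis
  proof cases
    case 1
    define s where "s = sqrt a"
    define r where "r = sqrt b"
    have sr: "s > 0" "r > 0" "a = s * s" "b = r * r" using 1 by (auto simp: s_def r_def)
    have "c \<le> a / (s / r) + b * (s / r)" using sr by (intro c) auto
    also have "\<dots> = 2 * (s * r)" using sr by (simp add: field_simps)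
    finally show ?thesis using 1 by (simp add: s_def r_def real_sqrt_mult)
  next
    case 2
    have "c \<le> 0"
    proof (rule field_le_epsilon)
      fix e :: real assume "e > 0"
      \<comment> \<open>Adding 1 keeps the denominator positive, since \<open>b\<close> may also be
        0 here.\<close>
      have "c \<le> b * (e / (b + 1))" using c[of "e / (b + 1)"] 2 b \<open>e > 0\<close> by simp
      also have "\<dots> \<le> e" using b \<open>e > 0\<close> by (simp add: field_simps)
      finally show "c \<le> 0 + e" by simp
    qed
    then show ?thesis using 2 by simp
  next
    case 3
    have "c \<le> 0"
    proof (rule field_le_epsilon)
      fix e :: real assume "e > 0"
      have "c \<le> a / ((a + 1) / e)" using c[of "(a + 1) / e"] 3 a \<open>e > 0\<close> by simp
      also have "\<dots> \<le> e" using a \<open>e > 0\<close> by (simp add: field_simps)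
      finally show "c \<le> 0 + e" by simp
    qed
    then show ?thesis using 3 by simp
  qed
qed

text \<open>With no moves made all weights are 1, so the objective is \<open>a / l + b * l\<close>
  with \<open>a = ln (card F)\<close> and \<open>b = 2 * T\<close>.\<close>

lemma ew_relaxation_Nil_le:
  assumes F: "finite F" "F \<noteq> {}"
  shows "ew_relaxation loss F T [] \<le> 2 * sqrt (2 * real T * ln (real (card F)))"
proof -
  have "card F \<ge> 1" using F by (simp add: Suc_le_eq card_gt_0_iff)
  then have "ew_relaxation loss F T [] \<le> 2 * sqrt (ln (card F) * (2 * real T))"
  proof (intro le_two_sqrtI)
    fix l :: real assume "l > 0"
    then have "ew_relaxation loss F T [] \<le> ew_objective loss F T [] l"
      using F by (intro ew_relaxation_le) auto
    then show "ew_relaxation loss F T [] \<le> ln (card F) / l + 2 * real T * l"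
      by (simp add: ew_objective_def mult_ac)
  qed auto
  then show ?thesis by (simp add: mult_ac)
qed

section \<open>Rademacher bound, admissibility and conclusion\<close>

lemma seq_rademacher_le_ew_relaxation:
  assumes F: "finite F" "F \<noteq> {}" and X: "X \<noteq> {}" and xs: "length xs \<le> T"
    and loss: "\<And>f x. f \<in> F \<Longrightarrow> x \<in> X \<Longrightarrow> \<bar>loss f x\<bar> \<le> 1"
  shows "seq_rademacher loss F X T xs \<le> ew_relaxation loss F T xs"
proof (rule ew_relaxation_ge)
  fix lam :: real assume lam: "lam > 0"
  define n where "n = T - length xs"
  obtain x0 where "x0 \<in> X" using X by auto
  \<comment> \<open>The real supremum over trees is bounded termwise, which requires at least one
    tree; a constant one is available.\<close>
  then have ne: "trees X n \<noteq> {}" by (auto simp: trees_def intro!: exI[of _ "\<lambda>_. x0"])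
  have "measure_pmf.expectation (rademacher n)
      (\<lambda>\<epsilon>. SUP f\<in>F. 2 * (\<Sum>i<n. \<epsilon> ! i * loss f (tr (take i \<epsilon>))) - (\<Sum>x\<leftarrow>xs. loss f x))
      \<le> 1 / lam * ln (\<Sum>f\<in>F. exp (- lam * (\<Sum>x\<leftarrow>xs. loss f x))) + 2 * lam * n"
    if "tr \<in> trees X n" for tr
    using that loss
    by (intro expectation_rademacher_SUP_le[OF F lam, where g = "\<lambda>f \<epsilon>. loss f (tr \<epsilon>)"])
       (auto simp: trees_def)
  then show "seq_rademacher loss F X T xs \<le> ew_objective loss F T xs lam"
    unfolding seq_rademacher_def Let_def n_def[symmetric]
    using xs by (intro cSUP_least[OF ne]) (simp add: ew_objective_def n_def of_nat_diff)
qed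

lemma admissible_algorithm_parameter_free_ew:
  assumes F: "finite F" "F \<noteq> {}"
    and loss: "\<And>f x. f \<in> F \<Longrightarrow> x \<in> X \<Longrightarrow> \<bar>loss f x\<bar> \<le> 1"
  shows "admissible_algorithm loss F X T (ew_relaxation loss F T) (parameter_free_ew loss F T)"
  unfolding admissible_algorithm_def
proof (intro allI impI conjI)
  fix xs assume xs: "set xs \<subseteq> X \<and> length xs < T"
  show "parameter_free_ew loss F T xs \<in> mixed F"
    using set_exp_weights[OF F] by (simp add: mixed_def parameter_free_ew_def)
  show "(SUP x\<in>X. ereal (measure_pmf.expectation (parameter_free_ew loss F T xs) (\<lambda>f. loss f x)
      + ew_relaxation loss F T (xs @ [x]))) \<le> ereal (ew_relaxation loss F T xs)"
    using parameter_free_ew_step[where loss = loss, OF F] xs loss by (intro SUP_least) auto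
qed

lemma admissible_relaxation_ew_relaxation:
  assumes F: "finite F" "F \<noteq> {}"
    and loss: "\<And>f x. f \<in> F \<Longrightarrow> x \<in> X \<Longrightarrow> \<bar>loss f x\<bar> \<le> 1"
  shows "admissible_relaxation loss F X T (ew_relaxation loss F T)"
  unfolding admissible_relaxation_def
proof (intro allI impI conjI)
  fix xs assume xs: "set xs \<subseteq> X \<and> length xs < T"
  have alg: "admissible_algorithm loss F X T (ew_relaxation loss F T) (parameter_free_ew loss F T)"
    using loss by (intro admissible_algorithm_parameter_free_ew[OF F])
  show "(INF q\<in>mixed F. SUP x\<in>X. ereal (measure_pmf.expectation q (\<lambda>f. loss f x)
      + ew_relaxation loss F T (xs @ [x]))) \<le> ereal (ew_relaxation loss F T xs)"
    \<comment> \<open>The strategy of the algorithm is the witness for the infimum over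
      \<open>mixed F\<close>.\<close>
    using alg xs unfolding admissible_algorithm_def by (blast intro: INF_lower2)
next
  fix xs assume xs: "set xs \<subseteq> X \<and> length xs = T"
  have "(INF f\<in>F. ereal (\<Sum>x\<leftarrow>xs. loss f x)) \<ge> ereal (- ew_relaxation loss F T xs)"
  proof (rule INF_greatest)
    fix f assume "f \<in> F"
    then have "- (\<Sum>x\<leftarrow>xs. loss f x) \<le> ew_relaxation loss F T xs"
      using F xs by (intro ew_relaxation_ge ew_objective_ge) auto
    then show "ereal (- ew_relaxation loss F T xs) \<le> ereal (\<Sum>x\<leftarrow>xs. loss f x)" by simp
  qed
  then show "- (INF f\<in>F. ereal (\<Sum>x\<leftarrow>xs. loss f x)) \<le> ereal (ew_relaxation loss F T xs)"
    by (metis ereal_uminus_le_reorder uminus_ereal.simps(1))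
qed

theorem proposition3:
  fixes F :: "'f set" and X :: "'x set" and loss :: "'f \<Rightarrow> 'x \<Rightarrow> real" and T :: nat
  assumes "finite F" and "F \<noteq> {}" and "X \<noteq> {}"
    and "\<And>f x. f \<in> F \<Longrightarrow> x \<in> X \<Longrightarrow> \<bar>loss f x\<bar> \<le> 1"
  shows "admissible_relaxation loss F X T (ew_relaxation loss F T) \<and>
         (\<forall>xs. set xs \<subseteq> X \<and> length xs \<le> T \<longrightarrow>
           seq_rademacher loss F X T xs \<le> ew_relaxation loss F T xs) \<and>
         admissible_algorithm loss F X T (ew_relaxation loss F T) (parameter_free_ew loss F T) \<and>
         (\<forall>nature. (\<forall>h. set_pmf (nature h) \<subseteq> X) \<longrightarrow>
           expected_regret loss F T (parameter_free_ew loss F T) nature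
             \<le> ew_relaxation loss F T []) \<and>
         ew_relaxation loss F T [] \<le> 2 * sqrt (2 * real T * ln (real (card F)))"
proof (intro conjI allI impI)
  note F = assms(1, 2)
  show rel: "admissible_relaxation loss F X T (ew_relaxation loss F T)"
    using assms(4) by (intro admissible_relaxation_ew_relaxation[OF F])
  show alg: "admissible_algorithm loss F X T (ew_relaxation loss F T) (parameter_free_ew loss F T)"
    using assms(4) by (intro admissible_algorithm_parameter_free_ew[OF F])
  show "seq_rademacher loss F X T xs \<le> ew_relaxation loss F T xs"
    if "set xs \<subseteq> X \<and> length xs \<le> T" for xs
    using that assms(4) by (intro seq_rademacher_le_ew_relaxation[OF F assms(3)]) auto
  show "expected_regret loss F T (parameter_free_ew loss F T) nature \<le> ew_relaxation loss F T []"
    if "\<forall>h. set_pmf (nature h) \<subseteq> X" for nature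
    using that assms(4)
    by (intro expected_regret_le_relaxation[OF F(2) _ ew_relaxation_bounded[OF F] rel alg]) auto
  show "ew_relaxation loss F T [] \<le> 2 * sqrt (2 * real T * ln (real (card F)))"
    by (rule ew_relaxation_Nil_le[OF F])
qed

end
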